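(* Suppose $\tau\le 1/(4L_f)$ and $f\in C^2$. Let $v_{\mathbf 2}^n,\bar v_{\mathbf 2}^n$ be the BDF2 solution and its perturbed solution, let $v_{\mathbf 3}^n,\bar v_{\mathbf 3}^n$ be the BDF2-DC3 solution and its perturbed solution with perturbations $\varepsilon_{\mathbf 3}^n$, and let $\tilde v_{\mathbf 3}^n:=\bar v_{\mathbf 3}^n-v_{\mathbf 3}^n$, so that for $2\le n\le N$ $$\partial_\tau \tilde v_{\mathbf 3}^n=-\vartheta_{n-2}^{(n)}d_1^{(2)}\,\partial_\tau\tilde v_{\mathbf 3}^1+\sum_{i=2}^n\vartheta_{n-i}^{(n)}\Big(f(t_i,\bar v_{\mathbf 3}^i)-f(t_i,v_{\mathbf 3}^i)+\mathcal D_{2,3}f(t_i,v_{\mathbf 2}^i)-\mathcal D_{2,3}f(t_i,\bar v_{\mathbf 2}^i)+\varepsilon_{\mathbf 3}^i\Big).$$ Then for $2\le n\le N$ $$|\tilde v_{\mathbf 3}^{n}|\le 4\exp(4L_ft_{n-1})\Big(|\tilde v_{\mathbf 3}^{1}|+\tau|\partial_\tau\tilde v_{\mathbf 3}^1|+t_n\max_{2\le i\le n}\Big\{|\varepsilon_{\mathbf 3}^i|+\big|\mathcal D_{2,3}f(t_i,v_{\mathbf 2}^i)-\mathcal D_{2,3}f(t_i,\bar v_{\mathbf 2}^i)\big|\Big\}\Big).$$ Thus the variable-step BDF2-DC3 scheme is mesh-robustly stable, i.e. this stability estimate holds with a prefactor independent of the step ratios $r_n$.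
   Context: Problem: $v'(t)=f(t,v)$ for $0<t\le T$, $v(0)=v_0$, where $f$ is Lipschitz-continuous in $v$ with Lipschitz constant $L_f>0$. Mesh: $0=t_0<t_1<\cdots<t_N=T$ is an arbitrary mesh, $\tau_k:=t_k-t_{k-1}$ for $1\le k\le N$, $\tau:=\max_{1\le k\le N}\tau_k$, $r_k:=\tau_k/\tau_{k-1}$ for $k\ge2$. For a sequence $(w^n)$ put $\partial_\tau w^n:=(w^n-w^{n-1})/\tau_n$. BDF2 operator: $D_2w^n:=\sum_{j=1}^n d^{(n)}_{n-j}\partial_\tau w^j$ for $n\ge2$, with $d^{(n)}_0:=\frac{1+2r_n}{1+r_n}$, $d^{(n)}_1:=-\frac{r_n}{1+r_n}$, $d^{(n)}_j:=0$ for $j\ge2$. DOC kernels: $\vartheta_0^{(n)}:=1/d_0^{(n)}$ and $\vartheta_{n-j}^{(n)}:=-\frac1{d_0^{(j)}}\sum_{i=j+1}^n\vartheta_{n-i}^{(n)}d^{(i)}_{i-j}$ for $2\le j\le n-1$. Third-order correction: $\mathcal D_{2,3}f(t_n,w^n):=\frac13\big[r_n(\tau_n+\tau_{n-1})^2-(1+r_n)\tau_n^2\big]\,f[t_n,t_{n-1},t_{n-2}]$ for $n\ge2$, where $f[\cdot,\cdot,\cdot]$ is the Newton divided difference of the data $f(t_k,w^k)$ at $t_k$; equivalently $\mathcal D_{2,3}f(t_n,w^n)=\frac{\tau_n}{3}\big(\partial_\tau f(t_n,w^n)-\partial_\tau f(t_{n-1},w^{n-1})\big)$. Schemes (starting values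 at $t_0,t_1$ given): BDF2: $D_2v_{\mathbf 2}^n=f(t_n,v_{\mathbf 2}^n)$ for $n\ge2$; BDF2-DC3: $D_2v_{\mathbf 3}^n+\mathcal D_{2,3}f(t_n,v_{\mathbf 2}^n)=f(t_n,v_{\mathbf 3}^n)$ for $n\ge2$. Perturbed schemes: $D_2\bar v_{\mathbf 2}^n=f(t_n,\bar v_{\mathbf 2}^n)+\varepsilon_{\mathbf 2}^n$ and $D_2\bar v_{\mathbf 3}^n+\mathcal D_{2,3}f(t_n,\bar v_{\mathbf 2}^n)=f(t_n,\bar v_{\mathbf 3}^n)+\varepsilon_{\mathbf 3}^n$ for $n\ge2$, with bounded sequences $\{\varepsilon_{\mathbf 2}^n\},\{\varepsilon_{\mathbf 3}^n\}$. A stability estimate is called mesh-robust if its prefactor (constant) is independent of the step ratios $r_n$. *)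

theory Defs
  imports "HOL-Analysis.Analysis"
begin

section \<open>Meshes, step sizes and backward differences\<close>

text \<open>A mesh is a sequence of nodes \<open>t\<close>, of which only \<open>t 0, \<dots>, t N\<close> are relevant. By truncated
  subtraction, \<open>step t 0 = 0\<close>; hence \<open>ratio t k\<close> is meaningful for \<open>k \<ge> 2\<close> only.\<close>

definition is_mesh :: "real \<Rightarrow> nat \<Rightarrow> (nat \<Rightarrow> real) \<Rightarrow> bool" where
  "is_mesh T N t \<longleftrightarrow> t 0 = 0 \<and> t N = T \<and> (\<forall>k\<in>{1..N}. t (k - 1) < t k)"

definition step :: "(nat \<Rightarrow> real) \<Rightarrow> nat \<Rightarrow> real" where
  "step t k = t k - t (k - 1)"

definition max_step :: "(nat \<Rightarrow> real) \<Rightarrow> nat \<Rightarrow> real" where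
  "max_step t N = Max (step t ` {1..N})"

definition ratio :: "(nat \<Rightarrow> real) \<Rightarrow> nat \<Rightarrow> real" where
  "ratio t k = step t k / step t (k - 1)"

definition bdiff :: "(nat \<Rightarrow> real) \<Rightarrow> (nat \<Rightarrow> real) \<Rightarrow> nat \<Rightarrow> real" where
  "bdiff t w n = (w n - w (n - 1)) / step t n"


section \<open>The variable-step BDF2 operator and its DOC kernels\<close>

text \<open>\<open>bdf2_kernel t n j\<close> is $d^{(n)}_j$.\<close>

definition bdf2_kernel :: "(nat \<Rightarrow> real) \<Rightarrow> nat \<Rightarrow> nat \<Rightarrow> real" where
  "bdf2_kernel t n j =
     (if j = 0 then (1 + 2 * ratio t n) / (1 + ratio t n)
      else if j = 1 then - (ratio t n / (1 + ratio t n))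
      else 0)"

definition D2 :: "(nat \<Rightarrow> real) \<Rightarrow> (nat \<Rightarrow> real) \<Rightarrow> nat \<Rightarrow> real" where
  "D2 t w n = (\<Sum>j=1..n. bdf2_kernel t n (n - j) * bdiff t w j)"

text \<open>\<open>doc_kernel t n k\<close> is $\vartheta^{(n)}_k$. The defining recursion is indexed by \<open>j = n - k\<close>, so
  its range \<open>2 \<le> j \<le> n - 1\<close> is \<open>1 \<le> k \<le> n - 2\<close>; values for larger \<open>k\<close> are irrelevant.\<close>

function doc_kernel :: "(nat \<Rightarrow> real) \<Rightarrow> nat \<Rightarrow> nat \<Rightarrow> real" where
  "doc_kernel t n k =
     (if k = 0 then 1 / bdf2_kernel t n 0
      else - (1 / bdf2_kernel t (n - k) 0) *
             (\<Sum>i = n - k + 1..n. doc_kernel t n (n - i) * bdf2_kernel t i (i - (n - k))))"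
  by pat_completeness auto
termination
  by (relation "Wellfounded.measure (\<lambda>(t, n, k). k)") auto

declare doc_kernel.simps [simp del]

lemma doc_kernel_0: "doc_kernel t n 0 = 1 / bdf2_kernel t n 0"
  by (simp add: doc_kernel.simps)

lemma doc_kernel_rec:
  assumes "2 \<le> j" "j \<le> n - 1"
  shows "doc_kernel t n (n - j) =
    - (1 / bdf2_kernel t j 0) * (\<Sum>i=j+1..n. doc_kernel t n (n - i) * bdf2_kernel t i (i - j))"
proof -
  have "n - j \<noteq> 0" "n - (n - j) = j"
    using assms by auto
  then show ?thesis
    by (subst doc_kernel.simps) simp
qed


section \<open>The third-order correction\<close>

text \<open>\<open>divdiff t g n k\<close> is the Newton divided difference $g[t_n, t_{n-1}, \ldots, t_{n-k}]$ of the
  data \<open>g i\<close> at the nodes \<open>t i\<close>.\<close>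

fun divdiff :: "(nat \<Rightarrow> real) \<Rightarrow> (nat \<Rightarrow> real) \<Rightarrow> nat \<Rightarrow> nat \<Rightarrow> real" where
  "divdiff t g n 0 = g n"
| "divdiff t g n (Suc k) = (divdiff t g n k - divdiff t g (n - 1) k) / (t n - t (n - Suc k))"

definition D23 :: "(real \<Rightarrow> real \<Rightarrow> real) \<Rightarrow> (nat \<Rightarrow> real) \<Rightarrow> (nat \<Rightarrow> real) \<Rightarrow> nat \<Rightarrow> real" where
  "D23 f t w n =
     1 / 3 * (ratio t n * (step t n + step t (n - 1))\<^sup>2 - (1 + ratio t n) * (step t n)\<^sup>2)
       * divdiff t (\<lambda>k. f (t k) (w k)) n 2"

lemma D23_eq_bdiff:
  assumes "is_mesh T N t" "2 \<le> n" "n \<le> N"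
  shows "D23 f t w n =
    step t n / 3 * (bdiff t (\<lambda>k. f (t k) (w k)) n - bdiff t (\<lambda>k. f (t k) (w k)) (n - 1))"
proof -
  obtain m where n: "n = Suc (Suc m)"
    using assms(2) by (metis add_2_eq_Suc le_Suc_ex)
  define a b where "a = step t n" and "b = step t (n - 1)"
  have mono: "t (k - 1) < t k" if "k \<in> {1..N}" for k
    using assms(1) that unfolding is_mesh_def by blast
  have pos: "a > 0" "b > 0"
    using mono[of n] mono[of "n - 1"] assms(2,3) by (auto simp: a_def b_def step_def n)
  have diff: "t n - t (n - 1) = a" "t (n - 1) - t (n - 2) = b" "t n - t (n - 2) = a + b"
    by (auto simp: a_def b_def step_def n)
  have coeff: "ratio t n * (a + b)\<^sup>2 - (1 + ratio t n) * a\<^sup>2 = a * (a + b)"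
    using pos unfolding ratio_def a_def[symmetric] b_def[symmetric]
    by (simp add: field_simps power2_eq_square)
  have dd: "divdiff t g n 2 = (bdiff t g n - bdiff t g (n - 1)) / (a + b)" for g
    using diff by (simp add: n numeral_2_eq_2 bdiff_def step_def)
  show ?thesis
    unfolding D23_def dd a_def[symmetric] b_def[symmetric] coeff using pos by (simp add: add_pos_pos divide_simps) (simp add: algebra_simps)
qed


section \<open>The schemes and their perturbations\<close>

definition bdf2 :: "(real \<Rightarrow> real \<Rightarrow> real) \<Rightarrow> (nat \<Rightarrow> real) \<Rightarrow> nat \<Rightarrow> (nat \<Rightarrow> real) \<Rightarrow> bool" where
  "bdf2 f t N v \<longleftrightarrow> (\<forall>n\<in>{2..N}. D2 t v n = f (t n) (v n))"

definition bdf2_perturbed ::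
  "(real \<Rightarrow> real \<Rightarrow> real) \<Rightarrow> (nat \<Rightarrow> real) \<Rightarrow> nat \<Rightarrow> (nat \<Rightarrow> real) \<Rightarrow> (nat \<Rightarrow> real) \<Rightarrow> bool" where
  "bdf2_perturbed f t N \<epsilon> v \<longleftrightarrow> (\<forall>n\<in>{2..N}. D2 t v n = f (t n) (v n) + \<epsilon> n)"

definition bdf2_dc3 ::
  "(real \<Rightarrow> real \<Rightarrow> real) \<Rightarrow> (nat \<Rightarrow> real) \<Rightarrow> nat \<Rightarrow> (nat \<Rightarrow> real) \<Rightarrow> (nat \<Rightarrow> real) \<Rightarrow> bool" where
  "bdf2_dc3 f t N v2 v3 \<longleftrightarrow> (\<forall>n\<in>{2..N}. D2 t v3 n + D23 f t v2 n = f (t n) (v3 n))"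

definition bdf2_dc3_perturbed ::
  "(real \<Rightarrow> real \<Rightarrow> real) \<Rightarrow> (nat \<Rightarrow> real) \<Rightarrow> nat \<Rightarrow> (nat \<Rightarrow> real) \<Rightarrow> (nat \<Rightarrow> real) \<Rightarrow> (nat \<Rightarrow> real)
     \<Rightarrow> bool" where
  "bdf2_dc3_perturbed f t N \<epsilon> v2 v3 \<longleftrightarrow>
     (\<forall>n\<in>{2..N}. D2 t v3 n + D23 f t v2 n = f (t n) (v3 n) + \<epsilon> n)"


section \<open>Regularity and mesh-robust stability\<close>

definition C2_on :: "'a::real_normed_vector set \<Rightarrow> ('a \<Rightarrow> 'b::real_normed_vector) \<Rightarrow> bool" where
  "C2_on S F \<longleftrightarrow>
     (\<exists>(F' :: 'a \<Rightarrow> 'a \<Rightarrow>\<^sub>L 'b) (F'' :: 'a \<Rightarrow> 'a \<Rightarrow>\<^sub>L ('a \<Rightarrow>\<^sub>L 'b)).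
        (\<forall>x\<in>S. (F has_derivative blinfun_apply (F' x)) (at x within S)) \<and>
        (\<forall>x\<in>S. (F' has_derivative blinfun_apply (F'' x)) (at x within S)) \<and>
        continuous_on S F'')"

text \<open>The prefactor \<open>C\<close> is chosen before the mesh, so it cannot depend on the step ratios (nor on
  \<open>N\<close>); it may depend on the problem data \<open>f\<close>, \<open>T\<close> and \<open>L\<close>.\<close>

definition bdf2_dc3_mesh_robustly_stable ::
  "(real \<Rightarrow> real \<Rightarrow> real) \<Rightarrow> real \<Rightarrow> real \<Rightarrow> bool" where
  "bdf2_dc3_mesh_robustly_stable f T L \<longleftrightarrow>
     (\<exists>C::real. \<forall>N t v2 v2b v3 v3b \<epsilon>2 \<epsilon>3.
        is_mesh T N t \<longrightarrow> max_step t N \<le> 1 / (4 * L) \<longrightarrow>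
        bounded (\<epsilon>2 ` {2..N}) \<longrightarrow> bounded (\<epsilon>3 ` {2..N}) \<longrightarrow>
        bdf2 f t N v2 \<longrightarrow> bdf2_perturbed f t N \<epsilon>2 v2b \<longrightarrow>
        bdf2_dc3 f t N v2 v3 \<longrightarrow> bdf2_dc3_perturbed f t N \<epsilon>3 v2b v3b \<longrightarrow>
        (\<forall>n\<in>{2..N}.
           \<bar>v3b n - v3 n\<bar> \<le> C *
             (\<bar>v3b 1 - v3 1\<bar> + max_step t N * \<bar>bdiff t (\<lambda>k. v3b k - v3 k) 1\<bar>
              + t n * Max ((\<lambda>i. \<bar>\<epsilon>3 i\<bar> + \<bar>D23 f t v2 i - D23 f t v2b i\<bar>) ` {2..n}))))"

end

theory Submission
  imports Defs
begin

text \<open>With \<open>r\<close> the current step ratio and \<open>a = r / (1 + 2 * r)\<close>, the BDF2 operator acts on the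
  difference quotients \<open>w\<close> by the recursion \<open>w n = a * w (n - 1) + (1 - a) * D2 n\<close>, a convex
  combination in which \<open>0 \<le> a \<le> 1/2\<close> whatever the mesh is. Hence \<open>w n\<close> is at most
  \<open>w 1 / 2 ^ (n - 1)\<close> plus the maximum of the right-hand sides, and the geometric decay makes the
  contribution of \<open>w 1\<close> to the summed error at most \<open>max_step\<close> times \<open>w 1\<close>. The Lipschitz bound
  and a discrete Gronwall inequality for the running maximum of the error conclude. The
  representation of \<open>w n\<close> by DOC kernels is a telescoping sum.\<close>

section \<open>Elementary properties of meshes\<close>

lemma step_pos:
  assumes "is_mesh T N t" "1 \<le> k" "k \<le> N"
  shows "0 < step t k"
  using assms unfolding is_mesh_def step_def by auto

lemma ratio_pos:
  assumes "is_mesh T N t" "2 \<le> k" "k \<le> N"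
  shows "0 < ratio t k"
  unfolding ratio_def using assms by (intro divide_pos_pos step_pos[OF assms(1)]) auto

lemma step_le_max_step:
  assumes "1 \<le> k" "k \<le> N"
  shows "step t k \<le> max_step t N"
  unfolding max_step_def using assms by (intro Max_ge) auto

lemma mesh_mono:
  assumes "is_mesh T N t" "m \<le> n" "n \<le> N"
  shows "t m \<le> t n"
  using assms(2,3)
proof (induction n rule: dec_induct)
  case (step k)
  then show ?case
    using step_pos[OF assms(1), of "Suc k"] by (simp add: step_def)
qed simp

lemma mesh_nonneg:
  assumes "is_mesh T N t" "n \<le> N"
  shows "0 \<le> t n"
  using mesh_mono[OF assms(1) _ assms(2), of 0] assms(1) by (simp add: is_mesh_def)

lemma sum_step:
  assumes "1 \<le> n"
  shows "(\<Sum>k=2..<Suc n. step t k) = t n - t 1"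
  using assms by (induction n rule: dec_induct) (simp_all add: step_def)

section \<open>The BDF2 operator, its inversion by DOC kernels, and its convex recursion\<close>

lemma D2_eq:
  assumes "2 \<le> n"
  shows "D2 t w n = bdf2_kernel t n 0 * bdiff t w n + bdf2_kernel t n 1 * bdiff t w (n - 1)"
proof -
  have "D2 t w n = (\<Sum>j\<in>{n - 1, n}. bdf2_kernel t n (n - j) * bdiff t w j)"
    unfolding D2_def using assms
    by (intro sum.mono_neutral_right) (auto simp: bdf2_kernel_def)
  then show ?thesis
    using assms by simp
qed

lemma bdiff_diff: "bdiff t (\<lambda>k. u k - w k) n = bdiff t u n - bdiff t w n"
  by (simp add: bdiff_def diff_divide_distrib)

lemma D2_diff: "D2 t (\<lambda>k. u k - w k) n = D2 t u n - D2 t w n"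
  by (simp add: D2_def bdiff_diff right_diff_distrib sum_subtractf)

lemma bdf2_kernel_0_pos:
  assumes "is_mesh T N t" "2 \<le> n" "n \<le> N"
  shows "0 < bdf2_kernel t n 0"
  using ratio_pos[OF assms] by (simp add: bdf2_kernel_def)

text \<open>Since the BDF2 kernels vanish from index 2 on, only \<open>i = j + 1\<close> survives in
  the recursion that defines the DOC kernels. The resulting two-term identity is the discrete
  orthogonality relation.\<close>

lemma doc_kernel_step:
  assumes "is_mesh T N t" "2 \<le> j" "j < n" "n \<le> N"
  shows "doc_kernel t n (n - j) * bdf2_kernel t j 0
       = - (doc_kernel t n (n - Suc j) * bdf2_kernel t (Suc j) 1)"
proof -
  have "(\<Sum>i=j+1..n. doc_kernel t n (n - i) * bdf2_kernel t i (i - j))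
      = (\<Sum>i\<in>{Suc j}. doc_kernel t n (n - i) * bdf2_kernel t i (i - j))"
    using assms(2,3) by (intro sum.mono_neutral_right) (auto simp: bdf2_kernel_def)
  moreover have "bdf2_kernel t j 0 \<noteq> 0"
    using bdf2_kernel_0_pos[OF assms(1,2)] assms(3,4) by simp
  ultimately show ?thesis
    using assms(2,3) by (simp add: doc_kernel_rec)
qed

text \<open>The sum telescopes: by \<open>doc_kernel_step\<close>, the multiple of
  \<open>bdiff t w m\<close> contributed by \<open>D2 t w (Suc m)\<close> cancels the one left over
  from the first \<open>m\<close> indices. Only the two boundary terms remain.\<close>

lemma doc_kernel_partial_sum:
  assumes "is_mesh T N t" "n \<le> N" "2 \<le> m" "m \<le> n"
  shows "(\<Sum>i=2..m. doc_kernel t n (n - i) * D2 t w i)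
       = doc_kernel t n (n - m) * bdf2_kernel t m 0 * bdiff t w m
         + doc_kernel t n (n - 2) * bdf2_kernel t 2 1 * bdiff t w 1"
  using assms(3,4)
proof (induction m rule: dec_induct)
  case base
  then show ?case
    by (simp add: D2_eq algebra_simps)
next
  case (step m)
  then show ?case
    using doc_kernel_step[OF assms(1) step.hyps(1) _ assms(2)]
    by (simp add: D2_eq[of "Suc m"] distrib_left mult.assoc[symmetric])
qed

text \<open>This is the full telescoping sum: at \<open>m = n\<close> the leading factor
  \<open>doc_kernel t n 0 * bdf2_kernel t n 0\<close> equals 1.\<close>

lemma bdiff_doc_kernel:
  assumes "is_mesh T N t" "2 \<le> n" "n \<le> N"
  shows "bdiff t w n = - (doc_kernel t n (n - 2) * bdf2_kernel t 2 1 * bdiff t w 1)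
           + (\<Sum>i=2..n. doc_kernel t n (n - i) * D2 t w i)"
  using doc_kernel_partial_sum[OF assms(1,3,2) order_refl, of w] bdf2_kernel_0_pos[OF assms]
  by (simp add: doc_kernel_0)

text \<open>The two nonzero kernels add up to 1, so solving for the newest difference quotient
  yields weights with sum 1. Only the bounds on \<open>a\<close> are exported, which hides the step
  ratio from all later estimates.\<close>

lemma bdiff_recursion:
  assumes "is_mesh T N t" "2 \<le> n" "n \<le> N"
  obtains a where "0 \<le> a" "a \<le> 1 / 2" "bdiff t w n = a * bdiff t w (n - 1) + (1 - a) * D2 t w n"
proof
  define r where "r = ratio t n"
  have r: "0 < r"
    using ratio_pos[OF assms] by (simp add: r_def)
  show "0 \<le> r / (1 + 2 * r)" "r / (1 + 2 * r) \<le> 1 / 2"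
    using r by (simp_all add: field_simps)
  have a: "1 - r / (1 + 2 * r) = (1 + r) / (1 + 2 * r)"
    using r by (simp add: field_simps)
  have "D2 t w n = ((1 + 2 * r) * bdiff t w n - r * bdiff t w (n - 1)) / (1 + r)"
    using r by (simp add: D2_eq[OF assms(2)] bdf2_kernel_def r_def[symmetric] diff_divide_distrib)
  then have "(1 + r) * D2 t w n = (1 + 2 * r) * bdiff t w n - r * bdiff t w (n - 1)"
    using r by simp
  then have "bdiff t w n = (r * bdiff t w (n - 1) + (1 + r) * D2 t w n) / (1 + 2 * r)"
    using r by (simp add: field_simps)
  then show "bdiff t w n = r / (1 + 2 * r) * bdiff t w (n - 1) + (1 - r / (1 + 2 * r)) * D2 t w n"
    unfolding a by (simp add: add_divide_distrib[of "r * _"])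
qed

text \<open>Each step multiplies the influence of the first quotient by \<open>a\<close>, hence at
  least halves it, while convexity keeps the coefficient of \<open>M\<close> equal to 1, so the
  right-hand sides do not accumulate.\<close>

lemma bdiff_bound:
  assumes "is_mesh T N t" "1 \<le> n" "n \<le> N"
    and "\<And>i. 2 \<le> i \<Longrightarrow> i \<le> n \<Longrightarrow> \<bar>D2 t w i\<bar> \<le> M" and "0 \<le> M"
  shows "\<bar>bdiff t w n\<bar> \<le> \<bar>bdiff t w 1\<bar> / 2 ^ (n - 1) + M"
  using assms(2-4)
proof (induction n rule: dec_induct)
  case base
  then show ?case
    using assms(5) by simp
next
  case (step n)
  let ?b = "\<bar>bdiff t w 1\<bar> / 2 ^ (n - 1)"
  obtain a where a: "0 \<le> a" "a \<le> 1 / 2"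
      "bdiff t w (Suc n) = a * bdiff t w n + (1 - a) * D2 t w (Suc n)"
    using bdiff_recursion[OF assms(1), of "Suc n" w] step.hyps step.prems(1) by auto
  have "\<bar>bdiff t w n\<bar> \<le> ?b + M"
    using step.IH step.prems by simp
  moreover have "\<bar>D2 t w (Suc n)\<bar> \<le> M"
    using step.hyps step.prems(2) by simp
  ultimately have "a * \<bar>bdiff t w n\<bar> + (1 - a) * \<bar>D2 t w (Suc n)\<bar> \<le> a * (?b + M) + (1 - a) * M"
    using a by (intro add_mono mult_left_mono) auto
  also have "\<dots> = a * ?b + M"
    by (simp add: algebra_simps)
  also have "\<dots> \<le> 1 / 2 * ?b + M"
    using a by (intro add_mono mult_right_mono) auto
  also have "\<dots> = \<bar>bdiff t w 1\<bar> / 2 ^ (Suc n - 1) + M"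
    using step.hyps by (cases n) simp_all
  finally show ?case
    using a abs_triangle_ineq[of "a * bdiff t w n" "(1 - a) * D2 t w (Suc n)"]
    by (simp add: abs_mult)
qed

section \<open>Discrete Gronwall inequality and stability of the BDF2 operator\<close>

lemma discrete_gronwall:
  fixes a x :: "nat \<Rightarrow> real"
  assumes "m \<le> n"
    and "\<And>k. m \<le> k \<Longrightarrow> k < n \<Longrightarrow> 0 \<le> a k"
    and "\<And>k. m \<le> k \<Longrightarrow> k \<le> n \<Longrightarrow> x k \<le> A + (\<Sum>j=m..<k. a j * x j)"
    and "0 \<le> A"
  shows "x n \<le> A * exp (\<Sum>j=m..<n. a j)"
proof -
  \<comment> \<open>The induction bounds the majorant of \<open>x n\<close> instead of
    \<open>x n\<close> itself: its bound grows by the factor \<open>1 + a n\<close>, which is at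
    most \<open>exp (a n)\<close>.\<close>
  have "A + (\<Sum>j=m..<n. a j * x j) \<le> A * exp (\<Sum>j=m..<n. a j)"
    using assms(1-3)
  proof (induction n rule: dec_induct)
    case (step n)
    let ?y = "A + (\<Sum>j=m..<n. a j * x j)" and ?e = "exp (\<Sum>j=m..<n. a j)"
    have IH: "?y \<le> A * ?e"
      using step.IH step.prems by simp
    have a: "0 \<le> a n"
      using step.hyps step.prems(1) by simp
    have "x n \<le> A * ?e"
      using IH step.prems(2)[of n] step.hyps by simp
    then have "?y + a n * x n \<le> A * ?e + a n * (A * ?e)"
      using IH a by (intro add_mono mult_left_mono)
    also have "\<dots> = (1 + a n) * (A * ?e)"
      by (simp add: algebra_simps)
    also have "\<dots> \<le> exp (a n) * (A * ?e)"
      using assms(4) by (intro mult_right_mono exp_ge_add_one_self) auto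
    finally show ?case
      using step.hyps by (simp add: exp_add mult_ac)
  qed simp
  then show ?thesis
    using assms(1) assms(3)[of n] by simp
qed

lemma sum_step_halves:
  assumes "is_mesh T N t" "1 \<le> n" "n \<le> N"
  shows "(\<Sum>k=2..<Suc n. step t k / 2 ^ (k - 1)) \<le> max_step t N"
proof -
  have "(\<Sum>k=2..<Suc n. step t k / 2 ^ (k - 1)) \<le> (\<Sum>k=2..<Suc n. max_step t N / 2 ^ (k - 1))"
    using assms by (intro sum_mono divide_right_mono step_le_max_step) auto
  \<comment> \<open>Closed form of the partial geometric series 1/2 + 1/4 + ... with
    \<open>n - 1\<close> terms.\<close>
  also have "\<dots> = max_step t N - max_step t N / 2 ^ (n - 1)"
    using assms(2)
  proof (induction n rule: dec_induct)
    case (step n)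
    then show ?case
      by (cases n) (simp_all add: field_simps)
  qed simp
  also have "\<dots> \<le> max_step t N"
    using step_le_max_step[of 1 N t] step_pos[OF assms(1), of 1] assms by simp
  finally show ?thesis .
qed

text \<open>This isolates what the scheme has to supply: a bound on \<open>D2\<close> by a Lipschitz
  term plus a constant \<open>\<delta>\<close>. The running maximum \<open>E\<close> enters because
  \<open>bdiff_bound\<close> asks for one bound on all earlier values of \<open>D2\<close>.\<close>

lemma D2_stability:
  assumes mesh: "is_mesh T N t" and n: "2 \<le> n" "n \<le> N"
    and L: "0 < L" and tau: "max_step t N \<le> 1 / (4 * L)" and del: "0 \<le> \<delta>"
    and D2: "\<And>i. 2 \<le> i \<Longrightarrow> i \<le> n \<Longrightarrow> \<bar>D2 t w i\<bar> \<le> L * \<bar>w i\<bar> + \<delta>"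
  shows "\<bar>w n\<bar> \<le> 4 * exp (4 * L * t (n - 1))
           * (\<bar>w 1\<bar> + max_step t N * \<bar>bdiff t w 1\<bar> + t n * \<delta>)"
proof -
  define E where "E k = Max ((\<lambda>i. \<bar>w i\<bar>) ` {1..k})" for k
  define A where "A = \<bar>w 1\<bar> + max_step t N * \<bar>bdiff t w 1\<bar> + t n * \<delta>"
  have le_E: "\<bar>w i\<bar> \<le> E k" if "1 \<le> i" "i \<le> k" for i k
    unfolding E_def using that by (intro Max_ge) auto
  have E_mono: "E k \<le> E l" if "1 \<le> k" "k \<le> l" for k l
    unfolding E_def using that by (intro Max_mono) auto
  have E_nonneg: "0 \<le> E k" if "1 \<le> k" for k
    using le_E[of 1 k] that by simp
  have step_nonneg: "0 \<le> step t k" if "2 \<le> k" "k \<le> n" for k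
    using step_pos[OF mesh, of k] that n by simp
  have t1: "0 \<le> t 1" "0 \<le> t (n - 1)"
    using mesh_nonneg[OF mesh] n by auto
  have max_step_nonneg: "0 \<le> max_step t N"
    using step_le_max_step[of 1 N t] step_pos[OF mesh, of 1] n by simp
  have A_nonneg: "0 \<le> A"
    unfolding A_def using del max_step_nonneg mesh_nonneg[OF mesh n(2)] by simp

  have sum_bound: "\<bar>w m\<bar> \<le> A + (\<Sum>k=2..<Suc m. L * step t k * E k)" if m: "1 \<le> m" "m \<le> n" for m
  proof -
    \<comment> \<open>Apply \<open>bdiff_bound\<close> with \<open>M = L * E k + \<delta>\<close>
      and multiply by the step size.\<close>
    have incr: "\<bar>w k - w (k - 1)\<bar> \<le> \<bar>bdiff t w 1\<bar> * (step t k / 2 ^ (k - 1)) + \<delta> * step t k + L * step t k * E k"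
      if k: "2 \<le> k" "k \<le> m" for k
    proof -
      have "\<bar>D2 t w i\<bar> \<le> L * E k + \<delta>" if "2 \<le> i" "i \<le> k" for i
      proof -
        have "L * \<bar>w i\<bar> \<le> L * E k"
          using L le_E[of i k] that by (intro mult_left_mono) auto
        then show ?thesis
          using D2[of i] that k m by simp
      qed
      then have "\<bar>bdiff t w k\<bar> \<le> \<bar>bdiff t w 1\<bar> / 2 ^ (k - 1) + (L * E k + \<delta>)"
        using k m n L del E_nonneg[of k] by (intro bdiff_bound[OF mesh]) auto
      then have "step t k * \<bar>bdiff t w k\<bar> \<le> step t k * (\<bar>bdiff t w 1\<bar> / 2 ^ (k - 1) + (L * E k + \<delta>))"
        using step_nonneg k m by (intro mult_left_mono) auto
      moreover have "step t k * \<bar>bdiff t w k\<bar> = \<bar>w k - w (k - 1)\<bar>"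
        using step_pos[OF mesh, of k] k m n by (simp add: bdiff_def abs_divide)
      ultimately show ?thesis
        by (simp add: algebra_simps)
    qed
    have "w m - w 1 = (\<Sum>k=2..<Suc m. w k - w (k - 1))"
      using m(1) by (induction m rule: dec_induct) simp_all
    then have "\<bar>w m\<bar> \<le> \<bar>w 1\<bar> + (\<Sum>k=2..<Suc m. \<bar>w k - w (k - 1)\<bar>)"
      using sum_abs[of "\<lambda>k. w k - w (k - 1)" "{2..<Suc m}"] by linarith
    also have "(\<Sum>k=2..<Suc m. \<bar>w k - w (k - 1)\<bar>)
        \<le> (\<Sum>k=2..<Suc m. \<bar>bdiff t w 1\<bar> * (step t k / 2 ^ (k - 1)) + \<delta> * step t k + L * step t k * E k)"
      using incr by (intro sum_mono) auto
    also have "\<dots> = \<bar>bdiff t w 1\<bar> * (\<Sum>k=2..<Suc m. step t k / 2 ^ (k - 1)) + \<delta> * (t m - t 1)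
        + (\<Sum>k=2..<Suc m. L * step t k * E k)"
      by (simp only: sum.distrib sum_distrib_left[symmetric] sum_step[OF m(1)])
    also have "\<dots> \<le> \<bar>bdiff t w 1\<bar> * max_step t N + \<delta> * t n + (\<Sum>k=2..<Suc m. L * step t k * E k)"
      using m n del t1 mesh_mono[OF mesh m(2) n(2)]
      by (intro add_mono mult_left_mono sum_step_halves[OF mesh] order_refl) auto
    finally show ?thesis
      by (simp add: A_def mult_ac)
  qed

  have E_bound: "E m \<le> A + (\<Sum>k=2..<Suc m. L * step t k * E k)" if m: "1 \<le> m" "m \<le> n" for m
  proof -
    \<comment> \<open>The maximum is attained at some \<open>i \<le> m\<close>; the bound for
      \<open>w i\<close> then extends from \<open>i\<close> to \<open>m\<close> because all summands
      are nonnegative.\<close>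
    have "E m \<in> (\<lambda>i. \<bar>w i\<bar>) ` {1..m}"
      unfolding E_def using m by (intro Max_in) auto
    then obtain i where i: "1 \<le> i" "i \<le> m" "E m = \<bar>w i\<bar>"
      by auto
    have "(\<Sum>k=2..<Suc i. L * step t k * E k) \<le> (\<Sum>k=2..<Suc m. L * step t k * E k)"
      using i m L step_nonneg E_nonneg by (intro sum_mono2) auto
    then show ?thesis
      using sum_bound[of i] i m by simp
  qed

  \<comment> \<open>Since \<open>L * step t m \<le> 1 / 4\<close>, the last summand can be absorbed into the left-hand side.\<close>
  have absorbed: "E m \<le> 4 / 3 * A + (\<Sum>k=2..<m. 4 / 3 * (L * step t k) * E k)"
    if m: "2 \<le> m" "m \<le> n" for m
  proof -
    have "step t m \<le> 1 / (4 * L)"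
      using step_le_max_step[of m N t] tau m n by linarith
    then have "L * step t m \<le> 1 / 4"
      using L by (simp add: field_simps)
    then have "L * step t m * E m \<le> 1 / 4 * E m"
      using E_nonneg[of m] m by (intro mult_right_mono) auto
    then have "E m \<le> A + (\<Sum>k=2..<m. L * step t k * E k) + 1 / 4 * E m"
      using E_bound[of m] m by simp
    moreover have "(\<Sum>k=2..<m. 4 / 3 * (L * step t k) * E k)
        = 4 / 3 * (\<Sum>k=2..<m. L * step t k * E k)"
      by (simp add: sum_distrib_left mult.assoc)
    ultimately show ?thesis
      by linarith
  qed
  have "\<bar>w n\<bar> \<le> E n"
    using le_E n by simp
  \<comment> \<open>With the summand \<open>k = n\<close> absorbed, the Gronwall sum stops at
    \<open>n - 1\<close>; this is why the exponent contains \<open>t (n - 1)\<close> instead of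
    \<open>t n\<close>.\<close>
  also have "E n \<le> 4 / 3 * A * exp (\<Sum>k=2..<n. 4 / 3 * (L * step t k))"
    using n L A_nonneg absorbed step_nonneg by (intro discrete_gronwall) auto
  also have "(\<Sum>k=2..<n. 4 / 3 * (L * step t k)) = 4 / 3 * L * (t (n - 1) - t 1)"
  proof -
    have "(\<Sum>k=2..<n. 4 / 3 * (L * step t k)) = 4 / 3 * L * (\<Sum>k=2..<n. step t k)"
      by (simp add: sum_distrib_left mult.assoc)
    then show ?thesis
      using sum_step[of "n - 1" t] n by simp
  qed
  \<comment> \<open>Both constants 4/3 are relaxed to 4, and \<open>t 1\<close> is dropped from the
    exponent by \<open>0 \<le> t 1\<close>.\<close>
  also have "4 / 3 * A * exp (4 / 3 * L * (t (n - 1) - t 1)) \<le> 4 * A * exp (4 * L * t (n - 1))"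
  proof (intro mult_mono)
    have "4 / 3 * L * (t (n - 1) - t 1) \<le> 4 / 3 * L * t (n - 1)"
      using t1 L by (intro mult_left_mono) auto
    also have "\<dots> \<le> 4 * L * t (n - 1)"
      using t1 L by (intro mult_right_mono) auto
    finally show "exp (4 / 3 * L * (t (n - 1) - t 1)) \<le> exp (4 * L * t (n - 1))"
      by simp
  qed (use A_nonneg in auto)
  also have "4 * A * exp (4 * L * t (n - 1)) = 4 * exp (4 * L * t (n - 1)) * A"
    by simp
  finally show ?thesis
    unfolding A_def .
qed

section \<open>The error equation of BDF2-DC3 and mesh-robust stability\<close>

lemma D2_dc3_error:
  assumes "bdf2_dc3 f t N v2 v3" "bdf2_dc3_perturbed f t N \<epsilon>3 v2b v3b" "2 \<le> n" "n \<le> N"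
  shows "D2 t (\<lambda>k. v3b k - v3 k) n
       = f (t n) (v3b n) - f (t n) (v3 n) + D23 f t v2 n - D23 f t v2b n + \<epsilon>3 n"
proof -
  have "D2 t v3 n + D23 f t v2 n = f (t n) (v3 n)"
    "D2 t v3b n + D23 f t v2b n = f (t n) (v3b n) + \<epsilon>3 n"
    using assms unfolding bdf2_dc3_def bdf2_dc3_perturbed_def by auto
  then show ?thesis
    by (simp add: D2_diff)
qed

text \<open>The corrections are evaluated at the BDF2 solutions, not at the BDF2-DC3 error, so their
  difference is a given source like \<open>\<epsilon>3\<close>. Thus \<open>D2_stability\<close>
  applies with \<open>\<delta>\<close> the maximum of both contributions.\<close>

lemma bdf2_dc3_stability:
  assumes L: "0 < L" and lip: "\<And>s. s \<in> {0..T} \<Longrightarrow> L-lipschitz_on UNIV (f s)"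
    and mesh: "is_mesh T N t" and tau: "max_step t N \<le> 1 / (4 * L)"
    and dc3: "bdf2_dc3 f t N v2 v3" "bdf2_dc3_perturbed f t N \<epsilon>3 v2b v3b"
    and n: "2 \<le> n" "n \<le> N"
  shows "\<bar>v3b n - v3 n\<bar> \<le> 4 * exp (4 * L * t (n - 1)) *
           (\<bar>v3b 1 - v3 1\<bar> + max_step t N * \<bar>bdiff t (\<lambda>k. v3b k - v3 k) 1\<bar>
            + t n * Max ((\<lambda>i. \<bar>\<epsilon>3 i\<bar> + \<bar>D23 f t v2 i - D23 f t v2b i\<bar>) ` {2..n}))"
proof (rule D2_stability[OF mesh n L tau])
  let ?g = "\<lambda>i. \<bar>\<epsilon>3 i\<bar> + \<bar>D23 f t v2 i - D23 f t v2b i\<bar>"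
  have g_le: "?g i \<le> Max (?g ` {2..n})" if "2 \<le> i" "i \<le> n" for i
    using that by (intro Max_ge) auto
  show "0 \<le> Max (?g ` {2..n})"
    using g_le[of 2] n by linarith
  show "\<bar>D2 t (\<lambda>k. v3b k - v3 k) i\<bar> \<le> L * \<bar>v3b i - v3 i\<bar> + Max (?g ` {2..n})"
    if i: "2 \<le> i" "i \<le> n" for i
  proof -
    \<comment> \<open>The Lipschitz bound is available only for times in this interval.\<close>
    have "t i \<in> {0..T}"
      using mesh_nonneg[OF mesh, of i] mesh_mono[OF mesh, of i N] mesh i n
      by (simp add: is_mesh_def)
    then have "\<bar>f (t i) (v3b i) - f (t i) (v3 i)\<bar> \<le> L * \<bar>v3b i - v3 i\<bar>"
      using lipschitz_onD[OF lip] by (simp add: dist_real_def)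
    then show ?thesis
      unfolding D2_dc3_error[OF dc3 i(1) order_trans[OF i(2) n(2)]] using g_le[OF i] by linarith
  qed
qed

text \<open>The prefactor must be chosen before the mesh, so \<open>t (n - 1)\<close> is replaced by
  its upper bound \<open>T\<close>, giving \<open>4 * exp (4 * L * T)\<close>.\<close>

lemma bdf2_dc3_mesh_robust:
  assumes L: "0 < L" and lip: "\<And>s. s \<in> {0..T} \<Longrightarrow> L-lipschitz_on UNIV (f s)"
  shows "bdf2_dc3_mesh_robustly_stable f T L"
  unfolding bdf2_dc3_mesh_robustly_stable_def
proof (intro exI allI impI ballI)
  fix N n :: nat and t v2 v2b v3 v3b \<epsilon>2 \<epsilon>3 :: "nat \<Rightarrow> real"
  assume mesh: "is_mesh T N t" and tau: "max_step t N \<le> 1 / (4 * L)"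
    and dc3: "bdf2_dc3 f t N v2 v3" "bdf2_dc3_perturbed f t N \<epsilon>3 v2b v3b" and "n \<in> {2..N}"
  then have n: "2 \<le> n" "n \<le> N"
    by auto
  let ?g = "\<lambda>i. \<bar>\<epsilon>3 i\<bar> + \<bar>D23 f t v2 i - D23 f t v2b i\<bar>"
  let ?R = "\<bar>v3b 1 - v3 1\<bar> + max_step t N * \<bar>bdiff t (\<lambda>k. v3b k - v3 k) 1\<bar>
    + t n * Max (?g ` {2..n})"
  note stab = bdf2_dc3_stability[OF L lip mesh tau dc3 n]
  \<comment> \<open>Enlarging the prefactor requires \<open>0 \<le> ?R\<close>. This follows from
    the estimate itself, whose left-hand side is an absolute value and whose prefactor is
    positive.\<close>
  have "0 \<le> (4 * exp (4 * L * t (n - 1))) * ?R"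
    using stab abs_ge_zero order_trans by blast
  then have "0 \<le> ?R"
    by (simp add: zero_le_mult_iff)
  moreover have "t (n - 1) \<le> T"
    using mesh_mono[OF mesh, of "n - 1" N] mesh n by (simp add: is_mesh_def)
  then have "4 * exp (4 * L * t (n - 1)) \<le> 4 * exp (4 * L * T)"
    using L by simp
  ultimately have "4 * exp (4 * L * t (n - 1)) * ?R \<le> 4 * exp (4 * L * T) * ?R"
    by (intro mult_right_mono)
  with stab show "\<bar>v3b n - v3 n\<bar> \<le> 4 * exp (4 * L * T) * ?R"
    by (rule order_trans)
qed

theorem theorem2p1:
  fixes f :: "real \<Rightarrow> real \<Rightarrow> real" and T L :: real and N :: nat
    and t v2 v2b v3 v3b \<epsilon>2 \<epsilon>3 err3 :: "nat \<Rightarrow> real"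
  assumes "T > 0" and "L > 0"
    and "\<And>s. s \<in> {0..T} \<Longrightarrow> L-lipschitz_on UNIV (f s)"
    and "C2_on ({0..T} \<times> UNIV) (\<lambda>(s, x). f s x)"
    and "is_mesh T N t"
    and "max_step t N \<le> 1 / (4 * L)"
    and "bounded (\<epsilon>2 ` {2..N})" and "bounded (\<epsilon>3 ` {2..N})"
    and "bdf2 f t N v2" and "bdf2_perturbed f t N \<epsilon>2 v2b"
    and "bdf2_dc3 f t N v2 v3" and "bdf2_dc3_perturbed f t N \<epsilon>3 v2b v3b"
    and "\<And>n. err3 n = v3b n - v3 n"
  shows "(\<forall>n\<in>{2..N}. bdiff t err3 n =
            - (doc_kernel t n (n - 2) * bdf2_kernel t 2 1 * bdiff t err3 1)
            + (\<Sum>i=2..n. doc_kernel t n (n - i) *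
                 (f (t i) (v3b i) - f (t i) (v3 i) + D23 f t v2 i - D23 f t v2b i + \<epsilon>3 i)))
       \<and> (\<forall>n\<in>{2..N}. \<bar>err3 n\<bar> \<le> 4 * exp (4 * L * t (n - 1)) *
            (\<bar>err3 1\<bar> + max_step t N * \<bar>bdiff t err3 1\<bar>
             + t n * Max ((\<lambda>i. \<bar>\<epsilon>3 i\<bar> + \<bar>D23 f t v2 i - D23 f t v2b i\<bar>) ` {2..n})))
       \<and> bdf2_dc3_mesh_robustly_stable f T L"
proof (intro conjI ballI)
  have err3: "err3 = (\<lambda>k. v3b k - v3 k)"
    using assms(13) by blast
  fix n assume "n \<in> {2..N}"
  then have n: "2 \<le> n" "n \<le> N"
    by auto
  show "bdiff t err3 n =
      - (doc_kernel t n (n - 2) * bdf2_kernel t 2 1 * bdiff t err3 1)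
      + (\<Sum>i=2..n. doc_kernel t n (n - i) *
           (f (t i) (v3b i) - f (t i) (v3 i) + D23 f t v2 i - D23 f t v2b i + \<epsilon>3 i))"
    unfolding bdiff_doc_kernel[OF assms(5) n] err3
    using n by (simp add: D2_dc3_error[OF assms(11,12)])
  show "\<bar>err3 n\<bar> \<le> 4 * exp (4 * L * t (n - 1)) *
      (\<bar>err3 1\<bar> + max_step t N * \<bar>bdiff t err3 1\<bar>
       + t n * Max ((\<lambda>i. \<bar>\<epsilon>3 i\<bar> + \<bar>D23 f t v2 i - D23 f t v2b i\<bar>) ` {2..n}))"
    unfolding err3 by (rule bdf2_dc3_stability[OF assms(2,3,5,6,11,12) n])
next
  show "bdf2_dc3_mesh_robustly_stable f T L"
    by (rule bdf2_dc3_mesh_robust[OF assms(2,3)])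
qed

end
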